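(* Let $\mathcal{H}=\mathbb{C}^2$ and let $\mathcal{GE}$ be the set of all entanglement breaking quantum channels on $\mathcal{L}(\mathcal{H})$. For every density operator $\tau$ on $\mathcal{H}\otimes\mathcal{H}$, $$C(\tau,\mathcal{GE})=\max_{\Psi\in\mathcal{GE}}\operatorname{tr}[\tau J_\Psi]\le\frac12\left(1+\sqrt{\|\boldsymbol{b}(\tau_2)\|^2+\|N(\tau)\|^2}\right),$$ where $\tau_2=\operatorname{tr}_1\tau$ and $\|N(\tau)\|$ is the operator norm of $N(\tau)$ induced by the Euclidean norm on $\mathbb{R}^3$.
   Context: A quantum channel is a linear, completely positive, trace preserving map on $\mathcal{L}(\mathcal{H})$; it is entanglement breaking if $(\mathrm{id}\otimes\Psi)(\rho)$ is separable for every density operator $\rho$ on $\mathcal{H}\otimes\mathcal{H}$. $J_\Psi=(\mathrm{id}\otimes\Psi)(P'_+)$ with $P'_+=\sum_{i,j=0}^1|i\rangle\langle j|\otimes|i\rangle\langle j|$ in the computational basis. $\operatorname{tr}_1$ is the partial trace over the first factor. Bloch vector: $b(X)_i=\operatorname{tr}[\sigma_iX]$, $i=1,2,3$, with Euclidean norm $\|\cdot\|$. Correlation matrix: $N(X)_{ij}=\operatorname{tr}[X(\sigma_i\otimes\sigma_j)]$, $i,j\in\{1,2,3\}$, $\sigma_i$ the Pauli matrices. *)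

theory Defs
  imports "HOL-Analysis.Analysis"
begin

text \<open>Operators on H = C^2 are 2x2 complex matrices (row index first, computational
basis 0,1). Operators on H (x) H are 4x4 complex matrices indexed by pairs:
entry ((i,k),(j,l)) is the coefficient of |i><j| (x) |k><l|.\<close>

type_synonym op2 = "complex^2^2"
type_synonym op4 = "complex^(2\<times>2)^(2\<times>2)"

definition mtrace :: "complex^'n^'n \<Rightarrow> complex" where
  "mtrace A = (\<Sum>i\<in>UNIV. A$i$i)"

definition quadform :: "complex^'n^'n \<Rightarrow> complex^'n \<Rightarrow> complex" where
  "quadform A v = (\<Sum>i\<in>UNIV. \<Sum>j\<in>UNIV. cnj (v$i) * A$i$j * v$j)"

text \<open>Positive semidefinite: <v, A v> is real and nonnegative for all v.\<close>
definition psd :: "complex^'n^'n \<Rightarrow> bool" where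
  "psd A \<longleftrightarrow> (\<forall>v. Im (quadform A v) = 0 \<and> Re (quadform A v) \<ge> 0)"

definition density :: "complex^'n^'n \<Rightarrow> bool" where
  "density A \<longleftrightarrow> psd A \<and> mtrace A = 1"

definition tensor :: "op2 \<Rightarrow> op2 \<Rightarrow> op4" where
  "tensor A B = (\<chi> p q. A$(fst p)$(fst q) * B$(snd p)$(snd q))"

definition cscale :: "complex \<Rightarrow> complex^'n^'m \<Rightarrow> complex^'n^'m" where
  "cscale c A = (\<chi> i j. c * A$i$j)"

text \<open>(id \<otimes> \<Psi>)(X)\<close>
definition id_tensor :: "(op2 \<Rightarrow> op2) \<Rightarrow> op4 \<Rightarrow> op4" where
  "id_tensor \<Psi> X = (\<chi> p q. (\<Psi> (\<chi> k l. X$(fst p,k)$(fst q,l)))$(snd p)$(snd q))"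

text \<open>Complex linearity of a map on L(H).\<close>
definition clinear_map :: "(op2 \<Rightarrow> op2) \<Rightarrow> bool" where
  "clinear_map \<Psi> \<longleftrightarrow> (\<forall>A B. \<Psi> (A + B) = \<Psi> A + \<Psi> B) \<and> (\<forall>c A. \<Psi> (cscale c A) = cscale c (\<Psi> A))"

text \<open>Block matrices on C^n (x) C^2: n x n blocks X i j, each a 2x2 matrix
(the operator sum_{i,j<n} |i><j| (x) X i j). Positivity of such a block matrix.\<close>
definition block_psd :: "nat \<Rightarrow> (nat \<Rightarrow> nat \<Rightarrow> op2) \<Rightarrow> bool" where
  "block_psd n X \<longleftrightarrow> (\<forall>v :: nat \<Rightarrow> complex^2.
     let q = (\<Sum>i<n. \<Sum>j<n. \<Sum>k\<in>UNIV. \<Sum>l\<in>UNIV. cnj (v i $ k) * (X i j)$k$l * v j $ l)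
     in Im q = 0 \<and> Re q \<ge> 0)"

text \<open>Complete positivity: id_n \<otimes> \<Psi> is positive for every n.\<close>
definition completely_positive :: "(op2 \<Rightarrow> op2) \<Rightarrow> bool" where
  "completely_positive \<Psi> \<longleftrightarrow>
     (\<forall>n X. block_psd n X \<longrightarrow> block_psd n (\<lambda>i j. \<Psi> (X i j)))"

definition trace_preserving :: "(op2 \<Rightarrow> op2) \<Rightarrow> bool" where
  "trace_preserving \<Psi> \<longleftrightarrow> (\<forall>A. mtrace (\<Psi> A) = mtrace A)"

definition quantum_channel :: "(op2 \<Rightarrow> op2) \<Rightarrow> bool" where
  "quantum_channel \<Psi> \<longleftrightarrow> clinear_map \<Psi> \<and> completely_positive \<Psi> \<and> trace_preserving \<Psi>"

text \<open>Separable states on H (x) H: finite convex combinations of product states.\<close>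
definition separable :: "op4 \<Rightarrow> bool" where
  "separable \<sigma> \<longleftrightarrow> (\<exists>n (p :: nat \<Rightarrow> real) A B.
     (\<forall>m<n. p m \<ge> 0 \<and> density (A m) \<and> density (B m)) \<and>
     \<sigma> = (\<Sum>m<n. cscale (complex_of_real (p m)) (tensor (A m) (B m))))"

definition entanglement_breaking :: "(op2 \<Rightarrow> op2) \<Rightarrow> bool" where
  "entanglement_breaking \<Psi> \<longleftrightarrow> quantum_channel \<Psi> \<and>
     (\<forall>\<rho> :: op4. density \<rho> \<longrightarrow> separable (id_tensor \<Psi> \<rho>))"

definition munit :: "2 \<Rightarrow> 2 \<Rightarrow> op2" where
  "munit i j = (\<chi> a b. if a = i \<and> b = j then 1 else 0)"

definition Pplus :: op4 where
  "Pplus = (\<Sum>i\<in>UNIV. \<Sum>j\<in>UNIV. tensor (munit i j) (munit i j))"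

definition choi :: "(op2 \<Rightarrow> op2) \<Rightarrow> op4" where
  "choi \<Psi> = id_tensor \<Psi> Pplus"

definition ptrace1 :: "op4 \<Rightarrow> op2" where
  "ptrace1 X = (\<chi> k l. \<Sum>i\<in>UNIV. X$(i,k)$(i,l))"

text \<open>Pauli matrices; index 0,1,2 of type 3 correspond to sigma_1, sigma_2, sigma_3.\<close>
definition pauli :: "3 \<Rightarrow> op2" where
  "pauli a = (if a = 0 then (\<chi> i j. if i = j then 0 else 1)
              else if a = 1 then (\<chi> i j. if i = j then 0 else if i = 0 then - \<i> else \<i>)
              else (\<chi> i j. if i = j then (if i = 0 then 1 else -1) else 0))"

definition bloch :: "op2 \<Rightarrow> real^3" where
  "bloch X = (\<chi> a. Re (mtrace (pauli a ** X)))"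

definition corr :: "op4 \<Rightarrow> real^3^3" where
  "corr X = (\<chi> a b. Re (mtrace (X ** tensor (pauli a) (pauli b))))"

end

theory Submission
  imports Defs
begin

text \<open>
  Since \<Psi> is entanglement breaking, the normalised Choi state \<sigma> = J/2 is separable,
  \<sigma> = \<Sum>_m p_m A_m \<otimes> B_m, and since \<Psi> is trace preserving the first marginal of \<sigma>
  is maximally mixed: \<Sum>_m p_m = 1 and the Bloch vectors x_m of the A_m average to 0.
  In Bloch coordinates 4 tr[\<tau> (A \<otimes> B)] = 1 + \<langle>a, x\<rangle> + \<langle>b, y\<rangle> + \<langle>x, N y\<rangle>, so the
  a-term averages out and 2 tr[\<tau> J] = 1 + \<Sum>_m p_m \<langle>w_m, y_m\<rangle> with w_m = b + N^T x_m.
  As |y_m| \<le> 1, Jensen gives \<Sum>_m p_m \<langle>w_m, y_m\<rangle> \<le> sqrt (\<Sum>_m p_m |w_m|^2); expanding the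
  square, the cross term averages out again, and |N^T x_m| \<le> \<parallel>N\<parallel> leaves |b|^2 + \<parallel>N\<parallel>^2.
\<close>

text \<open>The library enumerates the index types 2 and 3 from 1 (e.g. sum_2, forall_3), whereas
  pauli, bloch and the qubit matrices are indexed from 0.\<close>

lemma two_eq_zero_in_2: "(2::2) = 0" and three_eq_zero_in_3: "(3::3) = 0"
  by simp_all

lemma sum_UNIV_2: "sum f (UNIV::2 set) = f 0 + f 1"
  by (simp add: sum_2 two_eq_zero_in_2 add.commute)

lemma sum_UNIV_3: "sum f (UNIV::3 set) = f 0 + f 1 + f 2"
  by (simp add: sum_3 three_eq_zero_in_3 ac_simps)

lemma sum_UNIV_2x2: "sum f (UNIV::(2\<times>2) set) = f (0,0) + f (0,1) + f (1,0) + f (1,1)"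
proof -
  have "sum f (UNIV::(2\<times>2) set) = (\<Sum>i\<in>UNIV. \<Sum>j\<in>UNIV. f (i,j))"
    by (simp add: sum.cartesian_product)
  then show ?thesis by (simp add: sum_UNIV_2 add.assoc)
qed

lemma all_UNIV_2: "(\<forall>i::2. P i) \<longleftrightarrow> P 0 \<and> P 1"
  using forall_2[of P] by (simp add: two_eq_zero_in_2 conj_commute)

lemma weighted_mean_le_sqrt_weighted_mean_square:
  fixes p f :: "'i \<Rightarrow> real"
  assumes "finite I" and "\<And>i. i \<in> I \<Longrightarrow> p i \<ge> 0" and "(\<Sum>i\<in>I. p i) = 1"
  shows "(\<Sum>i\<in>I. p i * f i) \<le> sqrt (\<Sum>i\<in>I. p i * (f i)\<^sup>2)"
proof -
  have "I \<noteq> {}" using assms(3) by auto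
  then have "(\<Sum>i\<in>I. p i *\<^sub>R f i)\<^sup>2 \<le> (\<Sum>i\<in>I. p i * (f i)\<^sup>2)"
    using convex_on_sum[OF assms(1) _ convex_power2 assms(3,2)] by simp
  then show ?thesis by (simp add: real_le_rsqrt)
qed

lemma norm_vector_matrix_mult_le:
  fixes x :: "real^'m" and N :: "real^'n^'m"
  shows "norm (x v* N) \<le> onorm ((*v) N) * norm x"
proof -
  define u where "u = x v* N"
  have "(norm u)\<^sup>2 = inner x (N *v u)"
    by (simp add: u_def power2_norm_eq_inner dot_lmul_matrix)
  also have "\<dots> \<le> norm x * (onorm ((*v) N) * norm u)"
    using norm_cauchy_schwarz[of x "N *v u"] onorm[OF matrix_vector_mul_bounded_linear, of N u]
    by (meson mult_left_mono norm_ge_zero order_trans)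
  finally have "norm u * norm u \<le> (onorm ((*v) N) * norm x) * norm u"
    by (simp add: power2_eq_square algebra_simps)
  then show ?thesis
    using onorm_pos_le[OF matrix_vector_mul_bounded_linear, of N]
    by (cases "norm u = 0") (auto simp: u_def)
qed

lemma weighted_bilinear_le_sqrt:
  fixes p :: "'i \<Rightarrow> real" and x :: "'i \<Rightarrow> real^'m" and y :: "'i \<Rightarrow> real^'n"
    and b :: "real^'n" and N :: "real^'n^'m"
  assumes "finite I" and p_nonneg: "\<And>i. i \<in> I \<Longrightarrow> p i \<ge> 0"
    and p_sum: "(\<Sum>i\<in>I. p i) = 1" and centred: "(\<Sum>i\<in>I. p i *\<^sub>R x i) = 0"
    and x_le: "\<And>i. i \<in> I \<Longrightarrow> norm (x i) \<le> 1"
    and y_le: "\<And>i. i \<in> I \<Longrightarrow> norm (y i) \<le> 1"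
  shows "(\<Sum>i\<in>I. p i * (inner b (y i) + inner (x i) (N *v y i)))
           \<le> sqrt ((norm b)\<^sup>2 + (onorm ((*v) N))\<^sup>2)"
proof -
  define L where "L = onorm ((*v) N)"
  define w where "w i = b + x i v* N" for i
  have L_nonneg: "L \<ge> 0"
    unfolding L_def by (rule onorm_pos_le[OF matrix_vector_mul_bounded_linear])
  have "(\<Sum>i\<in>I. p i * (inner b (y i) + inner (x i) (N *v y i)))
      = (\<Sum>i\<in>I. p i * inner (w i) (y i))"
    by (simp add: w_def inner_add_left dot_lmul_matrix)
  also have "\<dots> \<le> (\<Sum>i\<in>I. p i * norm (w i))"
  proof (rule sum_mono, rule mult_left_mono)
    fix i assume "i \<in> I"
    show "inner (w i) (y i) \<le> norm (w i)"
      using norm_cauchy_schwarz[of "w i" "y i"] y_le[OF \<open>i \<in> I\<close>]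
      by (meson mult_left_le norm_ge_zero order_trans)
  qed (use p_nonneg in auto)
  also have "\<dots> \<le> sqrt (\<Sum>i\<in>I. p i * (norm (w i))\<^sup>2)"
    by (rule weighted_mean_le_sqrt_weighted_mean_square[OF assms(1) p_nonneg p_sum])
  also have "(\<Sum>i\<in>I. p i * (norm (w i))\<^sup>2)
      = (norm b)\<^sup>2 + 2 * inner (\<Sum>i\<in>I. p i *\<^sub>R x i) (N *v b)
        + (\<Sum>i\<in>I. p i * (norm (x i v* N))\<^sup>2)"
  proof -
    have "(norm (w i))\<^sup>2 = (norm b)\<^sup>2 + 2 * inner (x i) (N *v b) + (norm (x i v* N))\<^sup>2" for i
      using dot_norm[of b "x i v* N"] dot_lmul_matrix[of "x i" N b]
      by (simp add: w_def inner_commute[of b])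
    then have "(\<Sum>i\<in>I. p i * (norm (w i))\<^sup>2) = (\<Sum>i\<in>I. p i * (norm b)\<^sup>2
        + 2 * inner (p i *\<^sub>R x i) (N *v b) + p i * (norm (x i v* N))\<^sup>2)"
      by (simp add: distrib_left mult.left_commute)
    also have "\<dots> = (\<Sum>i\<in>I. p i) * (norm b)\<^sup>2 + 2 * inner (\<Sum>i\<in>I. p i *\<^sub>R x i) (N *v b)
        + (\<Sum>i\<in>I. p i * (norm (x i v* N))\<^sup>2)"
      by (simp only: sum.distrib sum_distrib_right sum_distrib_left inner_sum_left)
    finally show ?thesis by (simp add: p_sum)
  qed
  also have "\<dots> \<le> (norm b)\<^sup>2 + L\<^sup>2"
  proof -
    have "(\<Sum>i\<in>I. p i * (norm (x i v* N))\<^sup>2) \<le> (\<Sum>i\<in>I. p i * L\<^sup>2)"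
    proof (rule sum_mono, rule mult_left_mono)
      fix i assume "i \<in> I"
      have "norm (x i v* N) \<le> L"
        using norm_vector_matrix_mult_le[of "x i" N] x_le[OF \<open>i \<in> I\<close>] L_nonneg
        by (simp add: L_def) (meson mult_left_le order_trans)
      then show "(norm (x i v* N))\<^sup>2 \<le> L\<^sup>2" by (simp add: power_mono)
    qed (use p_nonneg in auto)
    also have "\<dots> = L\<^sup>2" by (simp add: p_sum flip: sum_distrib_right)
    finally show ?thesis by (simp add: centred)
  qed
  finally show ?thesis by (simp add: L_def)
qed

lemma mtrace_sum: "mtrace (\<Sum>m\<in>S. M m) = (\<Sum>m\<in>S. mtrace (M m))"
  by (simp add: mtrace_def sum.swap[of _ S])

lemma mtrace_cscale: "mtrace (cscale c M) = c * mtrace M"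
  by (simp add: mtrace_def cscale_def sum_distrib_left)

lemma mtrace_mult_sum:
  "mtrace (T ** (\<Sum>m\<in>S. M m)) = (\<Sum>m\<in>S. mtrace (T ** M m))"
  by (simp add: mtrace_def matrix_matrix_mult_def sum_distrib_left
      sum.swap[of _ S])

lemma mtrace_mult_cscale: "mtrace (T ** cscale c M) = c * mtrace (T ** M)"
  by (simp add: mtrace_def matrix_matrix_mult_def cscale_def sum_distrib_left algebra_simps)

lemma cscale_cscale: "cscale c (cscale d M) = cscale (c * d) M"
  by (simp add: cscale_def vec_eq_iff)

lemma bloch_sum: "bloch (\<Sum>m\<in>S. A m) = (\<Sum>m\<in>S. bloch (A m))"
  by (simp add: bloch_def vec_eq_iff mtrace_mult_sum Re_sum)

lemma bloch_cscale_of_real: "bloch (cscale (of_real r) A) = r *\<^sub>R bloch A"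
  by (simp add: bloch_def vec_eq_iff mtrace_mult_cscale)

definition ptrace2 :: "op4 \<Rightarrow> op2" where
  "ptrace2 X = (\<chi> i j. \<Sum>k\<in>UNIV. X$(i,k)$(j,k))"

lemma ptrace2_sum: "ptrace2 (\<Sum>m\<in>S. X m) = (\<Sum>m\<in>S. ptrace2 (X m))"
  by (simp add: ptrace2_def vec_eq_iff sum.swap[of _ S])

lemma ptrace2_cscale: "ptrace2 (cscale c X) = cscale c (ptrace2 X)"
  by (simp add: ptrace2_def cscale_def vec_eq_iff sum_distrib_left)

lemma ptrace2_tensor: "ptrace2 (tensor A B) = cscale (mtrace B) A"
  by (simp add: ptrace2_def tensor_def cscale_def mtrace_def vec_eq_iff sum_distrib_left
      mult.commute)

definition qubit_vec :: "complex \<Rightarrow> complex \<Rightarrow> complex^2" where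
  "qubit_vec a b = (\<chi> i. if i = 0 then a else b)"

lemma quadform_qubit_vec:
  "quadform (A::op2) (qubit_vec a b) =
     cnj a * A$0$0 * a + cnj a * A$0$1 * b + cnj b * A$1$0 * a + cnj b * A$1$1 * b"
  by (simp add: quadform_def qubit_vec_def sum_UNIV_2)

lemma psd_qubit_hermitian:
  assumes "psd (A::op2)"
  shows "Im (A$0$0) = 0" "Im (A$1$1) = 0" "A$0$1 = cnj (A$1$0)"
    and "Re (A$0$0) \<ge> 0" "Re (A$1$1) \<ge> 0"
proof -
  have q: "Im (quadform A v) = 0" "Re (quadform A v) \<ge> 0" for v
    using assms by (auto simp: psd_def)
  show "Im (A$0$0) = 0" "Re (A$0$0) \<ge> 0"
    using q[of "qubit_vec 1 0"] by (simp_all add: quadform_qubit_vec)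
  moreover show "Im (A$1$1) = 0" "Re (A$1$1) \<ge> 0"
    using q[of "qubit_vec 0 1"] by (simp_all add: quadform_qubit_vec)
  moreover have "Im (A$0$1) + Im (A$1$0) = 0" "Re (A$0$1) = Re (A$1$0)"
    using q[of "qubit_vec 1 1"] q[of "qubit_vec 1 \<i>"] calculation
    by (simp_all add: quadform_qubit_vec)
  ultimately show "A$0$1 = cnj (A$1$0)" by (simp add: complex_eq_iff)
qed

lemma psd_qubit_det:
  assumes "psd (A::op2)"
  shows "(cmod (A$1$0))\<^sup>2 \<le> Re (A$0$0) * Re (A$1$1)"
proof -
  note h = psd_qubit_hermitian[OF assms]
  define r0 r1 where "r0 = Re (A$0$0)" and "r1 = Re (A$1$1)"
  obtain u v where c: "A$1$0 = Complex u v" using complex.exhaust by blast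
  have A: "A$0$0 = of_real r0" "A$1$1 = of_real r1" "A$0$1 = Complex u (- v)" "A$1$0 = Complex u v"
    using h c by (simp_all add: r0_def r1_def complex_eq_iff)
  have q: "Re (quadform A w) \<ge> 0" for w
    using assms by (auto simp: psd_def)
  have "u\<^sup>2 + v\<^sup>2 \<le> r0 * r1"
  proof (cases "r0 + r1 = 0")
    case True
    then have "r0 = 0" "r1 = 0" using h(4,5) by (simp_all add: r0_def r1_def)
    then show ?thesis
      using q[of "qubit_vec 1 (- Complex u v)"]
      by (simp add: quadform_qubit_vec A power2_eq_square algebra_simps)
  next
    case False
    then have "r0 + r1 > 0" using h(4,5) by (simp add: r0_def r1_def)
    moreover have "0 \<le> r1 * (r0 * r1 - (u\<^sup>2 + v\<^sup>2))"
      using q[of "qubit_vec (of_real r1) (- Complex u v)"]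
      by (simp add: quadform_qubit_vec A power2_eq_square algebra_simps)
    moreover have "0 \<le> r0 * (r0 * r1 - (u\<^sup>2 + v\<^sup>2))"
      using q[of "qubit_vec (- Complex u (- v)) (of_real r0)"]
      by (simp add: quadform_qubit_vec A power2_eq_square algebra_simps)
    ultimately have "0 \<le> (r0 + r1) * (r0 * r1 - (u\<^sup>2 + v\<^sup>2))"
      by (simp add: distrib_right)
    with \<open>r0 + r1 > 0\<close> show ?thesis by (simp add: zero_le_mult_iff)
  qed
  then show ?thesis by (simp add: c cmod_power2 r0_def r1_def)
qed

lemma bloch_components:
  "bloch A $ 0 = Re (A$1$0 + A$0$1)" "bloch A $ 1 = Im (A$1$0) - Im (A$0$1)"
  "bloch A $ 2 = Re (A$0$0 - A$1$1)"
  by (simp_all add: bloch_def mtrace_def matrix_matrix_mult_def pauli_def sum_UNIV_2)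

definition bloch_op :: "real^3 \<Rightarrow> op2" where
  "bloch_op x = cscale (1/2) (mat 1 + (\<Sum>a\<in>UNIV. cscale (of_real (x$a)) (pauli a)))"

lemma bloch_op_components:
  "bloch_op x $ 0 $ 0 = of_real ((1 + x$2) / 2)" "bloch_op x $ 1 $ 1 = of_real ((1 - x$2) / 2)"
  "bloch_op x $ 0 $ 1 = Complex (x$0 / 2) (- x$1 / 2)"
  "bloch_op x $ 1 $ 0 = Complex (x$0 / 2) (x$1 / 2)"
  by (simp_all add: bloch_op_def cscale_def mat_def sum_UNIV_3 pauli_def
      complex_eq_iff)

lemma density_eq_bloch_op:
  assumes "density (A::op2)"
  shows "A = bloch_op (bloch A)"
proof -
  have "psd A" and "A$0$0 + A$1$1 = 1"
    using assms by (simp_all add: density_def mtrace_def sum_UNIV_2)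
  then show ?thesis
    using psd_qubit_hermitian
    by (simp add: vec_eq_iff all_UNIV_2 bloch_op_components bloch_components complex_eq_iff)
qed

lemma norm_bloch_le_1:
  assumes "density (A::op2)"
  shows "norm (bloch A) \<le> 1"
proof -
  have psd: "psd A" and tr: "Re (A$0$0) + Re (A$1$1) = 1"
    using assms by (simp_all add: density_def mtrace_def sum_UNIV_2 complex_eq_iff)
  note h = psd_qubit_hermitian[OF psd]
  have "(norm (bloch A))\<^sup>2 = 4 * (cmod (A$1$0))\<^sup>2 + (Re (A$0$0) - Re (A$1$1))\<^sup>2"
    by (simp add: power2_norm_eq_inner inner_vec_def sum_UNIV_3 bloch_components h(3) cmod_power2)
      (simp add: inner_complex_def power2_eq_square algebra_simps)
  also have "\<dots> \<le> (Re (A$0$0) + Re (A$1$1))\<^sup>2"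
    using psd_qubit_det[OF psd] by (simp add: power2_eq_square algebra_simps)
  finally show ?thesis using tr by (simp add: power_le_one_iff)
qed

lemma Re_mtrace_tensor_bloch_op:
  "4 * Re (mtrace (T ** tensor (bloch_op x) (bloch_op y))) =
     Re (mtrace T) + inner x (bloch (ptrace2 T)) + inner y (bloch (ptrace1 T))
     + inner x (corr T *v y)"
  by (simp add: mtrace_def matrix_matrix_mult_def tensor_def bloch_op_components ptrace1_def
      ptrace2_def bloch_components corr_def inner_vec_def matrix_vector_mult_def sum_UNIV_3
      sum_UNIV_2x2 sum_UNIV_2 pauli_def)
    (simp add: field_simps)

lemma Re_mtrace_tensor_density:
  assumes "density \<tau>" and "density A" and "density B"
  shows "4 * Re (mtrace (\<tau> ** tensor A B)) =
           1 + inner (bloch A) (bloch (ptrace2 \<tau>))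
           + (inner (bloch (ptrace1 \<tau>)) (bloch B) + inner (bloch A) (corr \<tau> *v bloch B))"
proof -
  have "A = bloch_op (bloch A)" "B = bloch_op (bloch B)"
    using assms(2,3) by (simp_all flip: density_eq_bloch_op)
  then show ?thesis
    using assms(1) Re_mtrace_tensor_bloch_op[of \<tau> "bloch A" "bloch B"]
    by (simp add: density_def inner_commute)
qed

lemma Pplus_components: "Pplus $ (i,k) $ (j,l) = (if i = k \<and> j = l then 1 else 0)"
  using exhaust_2[of i] exhaust_2[of j] exhaust_2[of k] exhaust_2[of l]
  by (auto simp: Pplus_def tensor_def munit_def sum_UNIV_2 two_eq_zero_in_2)

lemma choi_components: "choi \<Psi> $ (i,k) $ (j,l) = \<Psi> (munit i j) $ k $ l"
proof -
  have "(\<chi> k l. Pplus $ (i,k) $ (j,l)) = munit i j"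
    by (auto simp: vec_eq_iff Pplus_components munit_def)
  then show ?thesis by (simp add: choi_def id_tensor_def)
qed

lemma ptrace2_choi:
  assumes "trace_preserving \<Psi>"
  shows "ptrace2 (choi \<Psi>) = mat 1"
proof -
  have "ptrace2 (choi \<Psi>) $ i $ j = mat 1 $ i $ j" for i j
  proof -
    have "ptrace2 (choi \<Psi>) $ i $ j = mtrace (\<Psi> (munit i j))"
      by (simp add: ptrace2_def choi_components mtrace_def)
    also have "\<dots> = mtrace (munit i j)"
      using assms by (simp add: trace_preserving_def)
    also have "\<dots> = mat 1 $ i $ j"
      using exhaust_2[of i] exhaust_2[of j]
      by (auto simp: mtrace_def munit_def mat_def sum_UNIV_2 two_eq_zero_in_2)
    finally show ?thesis .
  qed
  then show ?thesis by (simp add: vec_eq_iff)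
qed

lemma density_half_Pplus: "density (cscale (1/2) Pplus)"
proof -
  have q: "quadform (cscale (1/2) Pplus) v = 1/2 * ((v$(0,0) + v$(1,1)) * cnj (v$(0,0) + v$(1,1)))"
    for v
    by (simp add: quadform_def sum_UNIV_2x2 cscale_def Pplus_components algebra_simps)
  have "psd (cscale (1/2) Pplus)"
    unfolding psd_def q complex_mult_cnj by simp
  moreover have "mtrace (cscale (1/2) Pplus) = 1"
    by (simp add: mtrace_def sum_UNIV_2x2 cscale_def Pplus_components)
  ultimately show ?thesis by (simp add: density_def psd_def)
qed

lemma id_tensor_cscale:
  assumes "clinear_map \<Psi>"
  shows "id_tensor \<Psi> (cscale c X) = cscale c (id_tensor \<Psi> X)"
proof -
  have blocks: "(\<chi> k l. cscale c X $ (i,k) $ (j,l)) = cscale c (\<chi> k l. X $ (i,k) $ (j,l))"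
    for i j by (simp add: cscale_def vec_eq_iff)
  have lin: "\<Psi> (cscale c A) = cscale c (\<Psi> A)" for A
    using assms by (simp add: clinear_map_def)
  show ?thesis
    unfolding id_tensor_def blocks lin by (simp add: vec_eq_iff cscale_def)
qed

lemma separable_half_choi:
  assumes "entanglement_breaking \<Psi>"
  shows "separable (cscale (1/2) (choi \<Psi>))"
  using assms density_half_Pplus
  by (auto simp: entanglement_breaking_def quantum_channel_def choi_def id_tensor_cscale)

lemma maximally_mixed_decomposition:
  assumes "\<forall>m<n. density (A m)"
    and "(\<Sum>m<n. cscale (of_real (p m)) (A m)) = cscale (1/2) (mat 1)"
  shows "(\<Sum>m<n. p m) = 1" and "(\<Sum>m<n. p m *\<^sub>R bloch (A m)) = 0"
proof -
  have "(\<Sum>m<n. of_real (p m) * mtrace (A m)) = mtrace (cscale (1/2) (mat 1 :: op2))"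
    using assms(2) by (simp flip: mtrace_sum mtrace_cscale)
  then have "(\<Sum>m<n. complex_of_real (p m)) = 1"
    using assms(1) by (simp add: density_def mtrace_def cscale_def mat_def sum_UNIV_2)
  then show "(\<Sum>m<n. p m) = 1" by (metis of_real_eq_1_iff of_real_sum)
  have "(\<Sum>m<n. p m *\<^sub>R bloch (A m)) = bloch (cscale (1/2) (mat 1))"
    by (simp add: bloch_sum bloch_cscale_of_real flip: assms(2))
  also have "\<dots> = 0"
    by (simp add: vec_eq_iff forall_3 three_eq_zero_in_3 bloch_components cscale_def mat_def)
  finally show "(\<Sum>m<n. p m *\<^sub>R bloch (A m)) = 0" .
qed

lemma Re_mtrace_separable_le:
  assumes "density \<tau>" and "separable \<sigma>" and marginal: "ptrace2 \<sigma> = cscale (1/2) (mat 1)"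
  shows "Re (mtrace (\<tau> ** \<sigma>))
           \<le> (1 + sqrt ((norm (bloch (ptrace1 \<tau>)))\<^sup>2 + (onorm ((*v) (corr \<tau>)))\<^sup>2)) / 4"
proof -
  obtain n p A B where states: "\<forall>m<(n::nat). p m \<ge> 0 \<and> density (A m) \<and> density (B m)"
    and decomp: "\<sigma> = (\<Sum>m<n. cscale (of_real (p m)) (tensor (A m) (B m)))"
    using assms(2) unfolding separable_def by blast
  define x y where "x m = bloch (A m)" and "y m = bloch (B m)" for m
  define b N where "b = bloch (ptrace1 \<tau>)" and "N = corr \<tau>"
  have "ptrace2 \<sigma> = (\<Sum>m<n. cscale (of_real (p m)) (A m))"
    unfolding decomp ptrace2_sum
    by (rule sum.cong)
      (use states in \<open>auto simp: ptrace2_cscale ptrace2_tensor density_def cscale_cscale\<close>)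
  then have p_sum: "(\<Sum>m<n. p m) = 1" and centred: "(\<Sum>m<n. p m *\<^sub>R x m) = 0"
    using maximally_mixed_decomposition[of n A p] states marginal by (simp_all add: x_def)
  have "4 * Re (mtrace (\<tau> ** \<sigma>))
      = (\<Sum>m<n. p m * (4 * Re (mtrace (\<tau> ** tensor (A m) (B m)))))"
    by (simp add: decomp mtrace_mult_sum mtrace_mult_cscale Re_sum sum_distrib_left
        mult.left_commute)
  also have "\<dots> = (\<Sum>m<n. p m * (1 + inner (x m) (bloch (ptrace2 \<tau>))
                      + (inner b (y m) + inner (x m) (N *v y m))))"
    using states assms(1) by (simp add: Re_mtrace_tensor_density x_def y_def b_def N_def)
  also have "\<dots> = 1 + inner (\<Sum>m<n. p m *\<^sub>R x m) (bloch (ptrace2 \<tau>))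
                 + (\<Sum>m<n. p m * (inner b (y m) + inner (x m) (N *v y m)))"
    by (simp add: p_sum distrib_left sum.distrib inner_sum_left flip: sum_distrib_right)
  also have "\<dots> \<le> 1 + sqrt ((norm b)\<^sup>2 + (onorm ((*v) N))\<^sup>2)"
    using weighted_bilinear_le_sqrt[of "{..<n}" p x y b N] states centred p_sum norm_bloch_le_1
    by (simp add: x_def y_def)
  finally show ?thesis by (simp add: b_def N_def)
qed

theorem proposition4:
  fixes \<tau> :: op4 and \<Psi> :: "op2 \<Rightarrow> op2"
  assumes "density \<tau>" and "entanglement_breaking \<Psi>"
  shows "Re (mtrace (\<tau> ** choi \<Psi>))
           \<le> 1/2 * (1 + sqrt ((norm (bloch (ptrace1 \<tau>)))\<^sup>2 + (onorm (\<lambda>x. corr \<tau> *v x))\<^sup>2))"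
proof -
  have "trace_preserving \<Psi>"
    using assms(2) by (simp add: entanglement_breaking_def quantum_channel_def)
  then have "ptrace2 (cscale (1/2) (choi \<Psi>)) = cscale (1/2) (mat 1)"
    by (simp add: ptrace2_cscale ptrace2_choi)
  then have "Re (mtrace (\<tau> ** cscale (1/2) (choi \<Psi>)))
      \<le> (1 + sqrt ((norm (bloch (ptrace1 \<tau>)))\<^sup>2 + (onorm (\<lambda>x. corr \<tau> *v x))\<^sup>2)) / 4"
    using Re_mtrace_separable_le[OF assms(1) separable_half_choi[OF assms(2)]] by simp
  then show ?thesis by (simp add: mtrace_mult_cscale)
qed

end
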